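(* Let $G$ and $G'$ be marked groups with centralizer trees $T_G$ and $T_{G'}$. If $G\cong G'$ as groups, then $\rho(T_G)=\rho(T_{G'})$.
   Context: Let $\mathbb{F}_\omega$ be the free group on countably many letters, with a fixed enumeration $(\gamma_i)_{i\in\mathbb{N}}$ of its elements. A marked group is $G=\mathbb{F}_\omega/N$ with $N\trianglelefteq\mathbb{F}_\omega$; it carries the enumeration $g_i:=\gamma_iN$, $i\in\mathbb{N}$ (repetitions allowed). For $s=(s_0,\dots,s_n)\in\mathbb{N}^{<\mathbb{N}}$ write $\{g_s\}=\{g_{s_0},\dots,g_{s_n}\}$, with $\{g_\emptyset\}=\emptyset$. The centralizer tree $T_G\subseteq\mathbb{N}^{<\mathbb{N}}$ is defined recursively, writing $(s,i)$ for the sequence $s$ extended by the term $i$: $\emptyset\in T_G$; and if $s\in T_G$ and $i\in\mathbb{N}$, then $(s,i)\in T_G$ if and only if $C_G(\{g_s\}\cup\{g_i\})\ne C_G(\{g_s\})$ (where $C_G(\emptyset)=G$). A tree is a set $T\subseteq\mathbb{N}^{<\mathbb{N}}$ closed under initial segments; it is well-founded if there is no $x\in\mathbb{N}^{\mathbb{N}}$ all of whose finite initial segments lie in $T$. For a nonempty well-founded tree $T$, define $\rho_T(t)=\sup\{\rho_T(s)+1\mid s\in T,\ t\subsetneq s\}$ (so $\rho_T(t)=0$ if $t$ has no proper extension in $T$) and $\rho(T)=\rho_T(\emptyset)+1$; put $\rho(\emptyset)=0$, and $\rho(T)=\omega_1$ if $T$ is not well-founded. *)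

theory Defs
  imports "HOL-Algebra.Coset" "HOL-Library.Sublist" "HOL-Library.Countable_Set"
begin

section \<open>The free group on countably many letters\<close>

text \<open>A letter is a pair \<open>(b, n)\<close>, standing for the generator \<open>x\<^sub>n\<close> if \<open>b\<close> is true and for its
  formal inverse otherwise. Group elements are words modulo insertion and deletion of
  factors \<open>a a\<^sup>-\<^sup>1\<close>.\<close>

type_synonym word = "(bool \<times> nat) list"

inductive word_eq :: "word \<Rightarrow> word \<Rightarrow> bool" where
  cancel: "word_eq (u @ [(b, n), (\<not> b, n)] @ v) (u @ v)"
| refl: "word_eq u u"
| sym: "word_eq u v \<Longrightarrow> word_eq v u"
| trans: "word_eq u v \<Longrightarrow> word_eq v w \<Longrightarrow> word_eq u w"

lemma equivp_word_eq: "equivp word_eq"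
  by (intro equivpI reflpI sympI transpI) (blast intro: word_eq.intros)+

quotient_type free_elt = word / word_eq
  by (rule equivp_word_eq)

lemma word_eq_append_left: "word_eq u v \<Longrightarrow> word_eq (w @ u) (w @ v)"
proof (induction rule: word_eq.induct)
  case (cancel u b n v)
  show ?case using word_eq.cancel[of "w @ u" b n v] by simp
qed (blast intro: word_eq.intros)+

lemma word_eq_append_right: "word_eq u v \<Longrightarrow> word_eq (u @ w) (v @ w)"
proof (induction rule: word_eq.induct)
  case (cancel u b n v)
  show ?case using word_eq.cancel[of u b n "v @ w"] by simp
qed (blast intro: word_eq.intros)+

lift_definition free_mult :: "free_elt \<Rightarrow> free_elt \<Rightarrow> free_elt" is append
  by (meson word_eq.trans word_eq_append_left word_eq_append_right)

lift_definition free_one :: free_elt is "[]" .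

definition F_omega :: "free_elt monoid" where
  "F_omega = \<lparr>carrier = UNIV, monoid.mult = free_mult, one = free_one\<rparr>"

lemma word_eq_inverse:
  "word_eq (rev (map (\<lambda>(b, n). (\<not> b, n)) w) @ w) []"
proof (induction w)
  case Nil
  show ?case by (simp add: word_eq.refl)
next
  case (Cons a w)
  obtain b n where a: "a = (b, n)" by (cases a)
  let ?w = "rev (map (\<lambda>(b, n). (\<not> b, n)) w)"
  have "word_eq (?w @ [(\<not> b, n), (\<not> \<not> b, n)] @ w) (?w @ w)" by (rule word_eq.cancel)
  with Cons have "word_eq (?w @ [(\<not> b, n), (\<not> \<not> b, n)] @ w) []" by (rule word_eq.trans[rotated])
  then show ?case by (simp add: a)
qed

lemma group_F_omega: "group F_omega"
proof (rule groupI)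
  fix x assume "x \<in> carrier F_omega"
  have "\<exists>y. free_mult y x = free_one"
    by transfer (use word_eq_inverse in blast)
  then show "\<exists>y\<in>carrier F_omega. y \<otimes>\<^bsub>F_omega\<^esub> x = \<one>\<^bsub>F_omega\<^esub>"
    by (simp add: F_omega_def)
next
  have "free_mult (free_mult x y) z = free_mult x (free_mult y z)" for x y z
    by transfer (simp add: word_eq.refl)
  then show "x \<otimes>\<^bsub>F_omega\<^esub> y \<otimes>\<^bsub>F_omega\<^esub> z = x \<otimes>\<^bsub>F_omega\<^esub> (y \<otimes>\<^bsub>F_omega\<^esub> z)" for x y z
    by (simp add: F_omega_def)
  have "free_mult free_one x = x" for x
    by transfer (simp add: word_eq.refl)
  then show "\<one>\<^bsub>F_omega\<^esub> \<otimes>\<^bsub>F_omega\<^esub> x = x" for x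
    by (simp add: F_omega_def)
qed (simp_all add: F_omega_def)


section \<open>Centralizer trees\<close>

definition centralizer :: "('a, 'b) monoid_scheme \<Rightarrow> 'a set \<Rightarrow> 'a set" where
  "centralizer G A = {x \<in> carrier G. \<forall>a\<in>A. x \<otimes>\<^bsub>G\<^esub> a = a \<otimes>\<^bsub>G\<^esub> x}"

inductive_set cent_tree :: "('a, 'b) monoid_scheme \<Rightarrow> (nat \<Rightarrow> 'a) \<Rightarrow> nat list set"
  for G and g where
  Nil: "[] \<in> cent_tree G g"
| snoc: "s \<in> cent_tree G g \<Longrightarrow>
    centralizer G (g ` set s \<union> {g i}) \<noteq> centralizer G (g ` set s) \<Longrightarrow>
    s @ [i] \<in> cent_tree G g"

lemma cent_tree_snoc_iff:
  "s \<in> cent_tree G g \<Longrightarrow> s @ [i] \<in> cent_tree G g \<longleftrightarrow>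
    centralizer G (g ` set s \<union> {g i}) \<noteq> centralizer G (g ` set s)"
  by (auto elim: cent_tree.cases intro: cent_tree.snoc)

text \<open>The carrier of \<open>F_omega Mod N\<close> consists of right cosets; for normal \<open>N\<close> these are the
  left cosets used here.\<close>

definition marked_enum :: "(nat \<Rightarrow> free_elt) \<Rightarrow> free_elt set \<Rightarrow> nat \<Rightarrow> free_elt set" where
  "marked_enum \<gamma> N i = \<gamma> i <#\<^bsub>F_omega\<^esub> N"

definition marked_cent_tree :: "(nat \<Rightarrow> free_elt) \<Rightarrow> free_elt set \<Rightarrow> nat list set" where
  "marked_cent_tree \<gamma> N = cent_tree (F_omega Mod N) (marked_enum \<gamma> N)"


section \<open>Ordinals\<close>

unbundle cardinal_syntax

text \<open>Order types of well-orders on subsets of the type \<^typ>\<open>nat set\<close>, i.e. the ordinals below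
  the successor cardinal of the continuum. This includes \<open>\<omega>\<^sub>1\<close>, there is no largest
  element, and every countable set has a strict upper bound (see below). Note that
  \<^const>\<open>ordIso\<close> relates well-orders only.\<close>

quotient_type ordinal = "nat set rel" / partial: "\<lambda>r r'. r =o r'"
proof (rule part_equivpI)
  show "\<exists>r::nat set rel. r =o r"
    using ordIso_reflexive[of "{}"] by auto
qed (auto intro!: sympI transpI intro: ordIso_symmetric ordIso_transitive)

lemma ordIso_self_Well_order: "r =o r \<Longrightarrow> Well_order r"
  by (auto simp: ordIso_def)

lemma rep_ordinal_self: "rep_ordinal \<alpha> =o rep_ordinal \<alpha>"
  by (rule Quotient3_rep_reflp[OF Quotient3_ordinal])

lemma abs_rep_ordinal: "abs_ordinal (rep_ordinal \<alpha>) = \<alpha>"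
  by (rule Quotient3_abs_rep[OF Quotient3_ordinal])

instantiation ordinal :: linorder
begin

lift_definition less_eq_ordinal :: "ordinal \<Rightarrow> ordinal \<Rightarrow> bool" is "\<lambda>r r'. r \<le>o r'"
  by (meson ordIso_ordLeq_trans ordIso_symmetric ordLeq_ordIso_trans)

lift_definition less_ordinal :: "ordinal \<Rightarrow> ordinal \<Rightarrow> bool" is "\<lambda>r r'. r <o r'"
  by (meson ordIso_ordLess_trans ordIso_symmetric ordLess_ordIso_trans)

instance
proof
  fix x y z :: ordinal
  show "x < y \<longleftrightarrow> x \<le> y \<and> \<not> y \<le> x"
    by transfer (blast dest: ordIso_self_Well_order ordLess_imp_ordLeq not_ordLess_ordLeq
        not_ordLeq_ordLess ordLess_or_ordLeq)
  show "x \<le> x" by transfer (simp add: ordIso_imp_ordLeq)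
  show "x \<le> y \<Longrightarrow> y \<le> z \<Longrightarrow> x \<le> z" by transfer (rule ordLeq_transitive)
  show "x \<le> y \<Longrightarrow> y \<le> x \<Longrightarrow> x = y" by transfer (simp add: ordIso_iff_ordLeq)
  show "x \<le> y \<or> y \<le> x"
    by transfer (blast dest: ordIso_self_Well_order ordLeq_total)
qed

end

lemma less_ordinal_rep: "x < y \<longleftrightarrow> rep_ordinal x <o rep_ordinal y"
  using less_ordinal.abs_eq[OF rep_ordinal_self rep_ordinal_self, of x y]
  by (simp add: abs_rep_ordinal)

instance ordinal :: wellorder
proof (intro_classes, rule ccontr)
  fix P :: "ordinal \<Rightarrow> bool" and a
  assume step: "\<And>x. (\<And>y. y < x \<Longrightarrow> P y) \<Longrightarrow> P x" and "\<not> P a"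
  have "wf {(x, y). (rep_ordinal x, rep_ordinal y) \<in> (ordLess :: (nat set rel \<times> nat set rel) set)}"
    using wf_inv_image[OF wf_ordLess, of rep_ordinal] by (simp add: inv_image_def)
  then have "wf {(x :: ordinal, y). x < y}" by (simp add: less_ordinal_rep)
  then have "P a" by (induction a rule: wf_induct_rule) (use step in auto)
  with \<open>\<not> P a\<close> show False ..
qed

instantiation ordinal :: conditionally_complete_linorder
begin

definition inf_ordinal :: "ordinal \<Rightarrow> ordinal \<Rightarrow> ordinal" where "inf_ordinal = min"
definition sup_ordinal :: "ordinal \<Rightarrow> ordinal \<Rightarrow> ordinal" where "sup_ordinal = max"
definition Inf_ordinal :: "ordinal set \<Rightarrow> ordinal" where "Inf (A :: ordinal set) = (LEAST \<alpha>. \<alpha> \<in> A)"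
definition Sup_ordinal :: "ordinal set \<Rightarrow> ordinal" where "Sup (A :: ordinal set) = (LEAST \<beta>. \<forall>\<alpha>\<in>A. \<alpha> \<le> \<beta>)"

instance
proof
  fix x z :: ordinal and X :: "ordinal set"
  show "x \<in> X \<Longrightarrow> Inf X \<le> x" by (simp add: Inf_ordinal_def Least_le)
  show "X \<noteq> {} \<Longrightarrow> (\<And>x. x \<in> X \<Longrightarrow> z \<le> x) \<Longrightarrow> z \<le> Inf X"
    unfolding Inf_ordinal_def by (metis (mono_tags) LeastI ex_in_conv)
  show "x \<in> X \<Longrightarrow> bdd_above X \<Longrightarrow> x \<le> Sup X"
    unfolding Sup_ordinal_def bdd_above_def
    by (drule LeastI_ex[of "\<lambda>\<beta>. \<forall>\<alpha>\<in>X. \<alpha> \<le> \<beta>"]) blast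
  show "(\<And>x. x \<in> X \<Longrightarrow> x \<le> z) \<Longrightarrow> Sup X \<le> z"
    unfolding Sup_ordinal_def by (simp add: Least_le)
qed (auto simp: inf_ordinal_def sup_ordinal_def)

end

instantiation ordinal :: zero
begin
lift_definition zero_ordinal :: ordinal is "{}"
  using ordIso_reflexive[of "{}"] by simp
instance ..
end

definition osuc :: "ordinal \<Rightarrow> ordinal" where
  "osuc \<alpha> = (LEAST \<beta>. \<alpha> < \<beta>)"

lift_definition omega1 :: ordinal is "cardSuc natLeq"
  by (simp add: ordIso_reflexive cardSuc_Card_order natLeq_Card_order card_order_on_well_order_on)


lemma zero_le_ordinal: "0 \<le> (\<alpha> :: ordinal)"
proof transfer
  fix r :: "nat set rel" assume "r =o r"
  then have r: "Well_order r" by (auto simp: ordIso_def)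
  show "({} :: nat set rel) \<le>o r"
  proof (rule ccontr)
    assume "\<not> ({} :: nat set rel) \<le>o r"
    then have "r <o ({} :: nat set rel)" using r not_ordLeq_iff_ordLess[of r "{} :: nat set rel"] by simp
    then show False using ordLess_iff_ordIso_Restr[of "{}" r] r by auto
  qed
qed

lemma Sup_ordinal_empty: "Sup {} = (0 :: ordinal)"
  unfolding Sup_ordinal_def
  by (rule Least_equality) (simp_all add: zero_le_ordinal)

lemma lessThan_ordinal_lepoll: "|{..<\<alpha>}| \<le>o |UNIV :: nat set set|" for \<alpha> :: ordinal
proof -
  define r where "r = rep_ordinal \<alpha>"
  have rr: "r =o r" and r: "Well_order r" and \<alpha>: "\<alpha> = abs_ordinal r"
    using rep_ordinal_self[of \<alpha>] by (auto simp: r_def abs_rep_ordinal ordIso_self_Well_order)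
  have "{..<\<alpha>} \<subseteq> (\<lambda>a. abs_ordinal (Restr r (underS r a))) ` UNIV"
  proof
    fix \<beta> assume "\<beta> \<in> {..<\<alpha>}"
    then have "rep_ordinal \<beta> <o r"
      by (simp add: less_ordinal_rep r_def)
    moreover have "rep_ordinal \<beta> =o rep_ordinal \<beta>"
      by (rule rep_ordinal_self)
    ultimately obtain a where "rep_ordinal \<beta> =o Restr r (underS r a)"
      using ordLess_iff_ordIso_Restr[OF r, of "rep_ordinal \<beta>"] ordIso_self_Well_order
      by blast
    then have "\<beta> = abs_ordinal (Restr r (underS r a))"
      using Quotient3_rel_abs[OF Quotient3_ordinal] abs_rep_ordinal
      by metis
    then show "\<beta> \<in> (\<lambda>a. abs_ordinal (Restr r (underS r a))) ` UNIV" by blast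
  qed
  then show ?thesis
    by (meson card_of_image card_of_mono1 ordLeq_transitive)
qed

lemma not_ordinal_lepoll: "\<not> |UNIV :: ordinal set| \<le>o |UNIV :: nat set set|"
proof
  assume "|UNIV :: ordinal set| \<le>o |UNIV :: nat set set|"
  then obtain f :: "ordinal \<Rightarrow> nat set" where f: "inj f"
    by (auto simp flip: card_of_ordLeq)
  define R where "R = {(x :: ordinal, y). x \<le> y}"
  have FR: "Field R = UNIV" by (auto simp: R_def Field_def)
  have wf: "wf {(x :: ordinal, y). x < y}" by (rule wf)
  have "R - Id = {(x, y). x < y}" by (auto simp: R_def)
  then have R: "Well_order R"
    using wf FR
    by (auto simp: well_order_on_def linear_order_on_def partial_order_on_def preorder_on_def
        R_def refl_on_def antisym_def total_on_def intro: transI)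
  define g where "g = (\<lambda>S. dir_image S f)"
  have g: "S =o g S" if "Well_order S" for S
    unfolding g_def by (rule dir_image_ordIso[OF that]) (use f in \<open>auto intro: inj_on_subset\<close>)
  have gg: "g S =o g S" if "Well_order S" for S
    using g[OF that] by (meson ordIso_symmetric ordIso_transitive)
  have gless: "g S <o g S'" if "Well_order S" "Well_order S'" "S <o S'" for S S'
    using ordIso_ordLess_trans[OF ordIso_symmetric[OF g[OF that(1)]]
        ordLess_ordIso_trans[OF that(3) g[OF that(2)]]] .
  let ?S = "\<lambda>a. Restr R (underS R a)"
  have S: "Well_order (?S a)" for a using R by (rule Well_order_Restr)
  have lt: "abs_ordinal (g (?S a)) < abs_ordinal (g (?S b))" if "a < b" for a b
  proof -
    have "?S a = Restr (?S b) (underS (?S b) a)"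
      using that by (auto simp: R_def underS_def)
    moreover have "(a, a) \<in> ?S b" using that by (auto simp: R_def underS_def)
    then have "Field (?S b) \<noteq> {}" by (auto simp: Field_def)
    ultimately have "?S a <o ?S b"
      using underS_Restr_ordLess[OF S, of b a] by simp
    then have "g (?S a) <o g (?S b)"
      by (rule gless[OF S S])
    then show ?thesis by (simp add: less_ordinal.abs_eq gg S)
  qed
  have ge: "a \<le> abs_ordinal (g (?S a))" for a
  proof (induction a rule: less_induct)
    case (less a)
    show ?case
    proof (rule ccontr)
      assume c: "\<not> a \<le> abs_ordinal (g (?S a))"
      let ?b = "abs_ordinal (g (?S a))"
      have "?b < a" using c by simp
      then have "?b \<le> abs_ordinal (g (?S ?b))" by (rule less)
      moreover have "abs_ordinal (g (?S ?b)) < ?b" by (rule lt[OF \<open>?b < a\<close>])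
      ultimately show False by simp
    qed
  qed
  have "?S a <o R" for a using underS_Restr_ordLess[OF R] FR by simp
  then have "g (?S a) <o g R" for a
    by (rule gless[OF S R])
  then have "abs_ordinal (g (?S a)) < abs_ordinal (g R)" for a
    by (simp add: less_ordinal.abs_eq gg S R)
  then have "a < abs_ordinal (g R)" for a using ge le_less_trans by blast
  then show False by blast
qed

lemma ordinal_strict_bound:
  assumes "countable A"
  shows "\<exists>\<beta> :: ordinal. \<forall>\<alpha>\<in>A. \<alpha> < \<beta>"
proof (rule ccontr)
  assume *: "\<nexists>\<beta>. \<forall>\<alpha>\<in>A. \<alpha> < \<beta>"
  let ?B = "UNIV :: nat set set"
  have inf: "infinite ?B" by (simp add: Finite_Set.finite_set)
  have "|{..\<alpha>}| \<le>o |?B|" for \<alpha> :: ordinal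
  proof -
    have "{..\<alpha>} = {..<\<alpha>} \<union> {\<alpha>}" by auto
    moreover have "|{\<alpha>}| \<le>o |?B|"
      by (simp add: card_of_singl_ordLeq)
    ultimately show ?thesis
      using card_of_Un_ordLeq_infinite_Field[of "|?B|" "{..<\<alpha>}" "{\<alpha>}"] inf
        lessThan_ordinal_lepoll by (metis Field_card_of card_of_Card_order)
  qed
  moreover have "|A| \<le>o |?B|"
  proof -
    obtain f :: "ordinal \<Rightarrow> nat" where "inj_on f A" using assms by (auto simp: countable_def)
    then have "inj_on (\<lambda>a. {f a}) A" by (auto simp: inj_on_def)
    then show ?thesis using card_of_ordLeq by blast
  qed
  ultimately have "|\<Union>\<alpha>\<in>A. {..\<alpha>}| \<le>o |?B|"
    using card_of_UNION_ordLeq_infinite[OF inf, of A "\<lambda>\<alpha>. {..\<alpha>}"] by blast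
  moreover have "(\<Union>\<alpha>\<in>A. {..\<alpha>}) = UNIV"
    using * by (auto simp: not_less)
  ultimately show False using not_ordinal_lepoll by simp
qed

corollary countable_bdd_above_ordinal: "countable A \<Longrightarrow> bdd_above (A :: ordinal set)"
  using ordinal_strict_bound by (meson bdd_aboveI less_imp_le)

lemma less_osuc: "\<alpha> < osuc \<alpha>"
  unfolding osuc_def using ordinal_strict_bound[of "{\<alpha>}"] by (auto intro: LeastI_ex)

lemma osuc_le_iff: "osuc \<alpha> \<le> \<beta> \<longleftrightarrow> \<alpha> < \<beta>"
  using less_osuc[of \<alpha>] by (auto simp: osuc_def intro: Least_le)


section \<open>Ranks of trees\<close>

definition is_tree :: "nat list set \<Rightarrow> bool" where
  "is_tree T \<longleftrightarrow> (\<forall>t\<in>T. \<forall>s. prefix s t \<longrightarrow> s \<in> T)"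

definition wf_tree :: "nat list set \<Rightarrow> bool" where
  "wf_tree T \<longleftrightarrow> (\<nexists>x :: nat \<Rightarrow> nat. \<forall>n. map x [0..<n] \<in> T)"

text \<open>The recursion is along proper extensions within the tree; it is justified for
  well-founded trees by the lemma \<open>node_rank_eq\<close> below. The suprema are over countable, hence
  bounded, sets of ordinals, and the empty supremum is \<open>0\<close> (\<open>Sup_ordinal_empty\<close>).\<close>

definition node_rank :: "nat list set \<Rightarrow> nat list \<Rightarrow> ordinal" where
  "node_rank T = wfrec {(s, t). s \<in> T \<and> t \<in> T \<and> strict_prefix t s}
     (\<lambda>\<rho> t. Sup {osuc (\<rho> s) | s. s \<in> T \<and> strict_prefix t s})"

definition tree_rank :: "nat list set \<Rightarrow> ordinal" where
  "tree_rank T =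
    (if T = {} then 0 else if wf_tree T then osuc (node_rank T []) else omega1)"

lemma wf_tree_imp_wf:
  assumes "is_tree T" "wf_tree T"
  shows "wf {(s, t). s \<in> T \<and> t \<in> T \<and> strict_prefix t s}"
proof (rule ccontr)
  assume "\<not> ?thesis"
  then obtain f where f: "\<And>i. f (Suc i) \<in> T \<and> f i \<in> T \<and> strict_prefix (f i) (f (Suc i))"
    unfolding wf_iff_no_infinite_down_chain by auto
  have len: "i \<le> length (f i)" for i
  proof (induction i)
    case (Suc i)
    then show ?case using f[of i] prefix_length_less by fastforce
  qed simp
  have mono: "prefix (f i) (f j)" if "i \<le> j" for i j
    using that
  proof (induction rule: dec_induct)
    case (step n)
    then show ?case using f[of n] by (meson prefix_order.trans strict_prefix_def)
  qed simp
  define x where "x n = f (Suc n) ! n" for n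
  have "map x [0..<n] = take n (f n)" for n
  proof (rule nth_equalityI)
    fix i assume "i < length (map x [0..<n])"
    then have "i < n" by simp
    then have "prefix (f (Suc i)) (f n)" using mono by simp
    then have "f n ! i = f (Suc i) ! i"
      using len[of "Suc i"] by (auto simp: prefix_def nth_append)
    then show "map x [0..<n] ! i = take n (f n) ! i"
      using \<open>i < n\<close> by (simp add: x_def)
  qed (use len in simp)
  then have "map x [0..<n] \<in> T" for n
    using assms(1) f[of n] unfolding is_tree_def by (metis take_is_prefix)
  then show False using assms(2) unfolding wf_tree_def by blast
qed

lemma node_rank_eq:
  assumes "is_tree T" "wf_tree T" "t \<in> T"
  shows "node_rank T t = Sup {osuc (node_rank T s) | s. s \<in> T \<and> strict_prefix t s}"
proof -
  let ?R = "{(s, t). s \<in> T \<and> t \<in> T \<and> strict_prefix t s}"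
  have "node_rank T t = Sup {osuc (cut (node_rank T) ?R t s) | s. s \<in> T \<and> strict_prefix t s}"
    unfolding node_rank_def by (subst wfrec[OF wf_tree_imp_wf[OF assms(1,2)]]) simp
  also have "{osuc (cut (node_rank T) ?R t s) | s. s \<in> T \<and> strict_prefix t s}
      = {osuc (node_rank T s) | s. s \<in> T \<and> strict_prefix t s}"
    using assms(3) by (force simp: cut_def)
  finally show ?thesis .
qed

lemma is_tree_cent_tree: "is_tree (cent_tree G g)"
proof -
  have "s \<in> cent_tree G g" if "t \<in> cent_tree G g" "prefix s t" for s t
    using that
  proof (induction arbitrary: s rule: cent_tree.induct)
    case Nil
    then show ?case by (simp add: cent_tree.Nil)
  next
    case (snoc t i)
    then show ?case by (auto simp: prefix_snoc intro: cent_tree.snoc)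
  qed
  then show ?thesis by (auto simp: is_tree_def)
qed

unbundle no cardinal_syntax

end

theory Submission
  imports Defs
begin

text \<open>
  The tree depends on the enumeration of the group, but its rank only sees which trees it can be
  embedded into in a weak sense: if a map \<open>\<phi>\<close> from a tree \<open>T\<close> to a tree \<open>T'\<close> preserves
  proper extension (it need not be injective), then infinite branches of \<open>T\<close> yield infinite
  branches of \<open>T'\<close>, and the rank of \<open>t\<close> in \<open>T\<close> is at most that of \<open>\<phi> t\<close> in \<open>T'\<close>
  (\<open>wf_tree_if_strict_prefix_map\<close>, \<open>node_rank_le_if_strict_prefix_map\<close>). Hence trees with such
  maps in both directions have the same rank (\<open>tree_rank_eqI\<close>).

  An isomorphism \<open>f\<close> of marked groups provides these maps. As the markings are surjective, every
  \<open>f (g i)\<close> occurs in the enumeration of the target, say at position \<open>h i\<close>. Since \<open>f\<close> carries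
  centralizers to centralizers, a strict drop of the centralizer along \<open>s\<close> becomes a strict drop
  along \<open>map h s\<close>, so \<open>map h\<close> sends the one centralizer tree into the other
  (\<open>map_in_cent_tree\<close>). The inverse of \<open>f\<close> gives the opposite direction.
\<close>

section \<open>Comparing ranks of trees\<close>

text \<open>The hypotheses of \<open>cSup_least\<close> exclude the empty set, which is the case of a leaf here;
  for ordinals the least upper bound exists also then.\<close>

lemma Sup_ordinal_least:
  fixes z :: ordinal
  assumes "\<And>x. x \<in> A \<Longrightarrow> x \<le> z"
  shows "Sup A \<le> z"
  unfolding Sup_ordinal_def by (rule Least_le) (use assms in blast)

lemma node_rank_strict_antimono:
  assumes "is_tree T" "wf_tree T" "s \<in> T" "t \<in> T" "strict_prefix t s"
  shows "node_rank T s < node_rank T t"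
proof -
  let ?A = "{osuc (node_rank T s) | s. s \<in> T \<and> strict_prefix t s}"
  have "?A \<subseteq> range (\<lambda>s. osuc (node_rank T s))" by blast
  then have "countable ?A" by (rule countable_subset) simp
  then have "osuc (node_rank T s) \<le> Sup ?A"
    by (intro cSup_upper countable_bdd_above_ordinal) (use assms in blast)+
  then show ?thesis
    by (simp add: osuc_le_iff node_rank_eq[OF assms(1,2,4)])
qed

lemma node_rank_antimono:
  assumes "is_tree T" "wf_tree T" "s \<in> T" "t \<in> T" "prefix t s"
  shows "node_rank T s \<le> node_rank T t"
  using node_rank_strict_antimono[OF assms(1-4)] assms(5)
  by (cases "t = s") (auto simp: strict_prefix_def less_imp_le)

text \<open>The images of the initial segments of a branch of \<open>T\<close> need not be the initial segments
  of a branch of \<open>T'\<close>, as \<open>\<phi>\<close> may skip levels; but they form an infinite ascending chain, which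
  well-foundedness of \<open>T'\<close> rules out as well.\<close>

lemma wf_tree_if_strict_prefix_map:
  assumes "is_tree T'" "wf_tree T'"
    and maps: "\<And>t. t \<in> T \<Longrightarrow> \<phi> t \<in> T'"
    and mono: "\<And>s t. s \<in> T \<Longrightarrow> t \<in> T \<Longrightarrow> strict_prefix t s \<Longrightarrow> strict_prefix (\<phi> t) (\<phi> s)"
  shows "wf_tree T"
  unfolding wf_tree_def
proof
  assume "\<exists>x. \<forall>n. map x [0..<n] \<in> T"
  then obtain x where x: "\<And>n. map x [0..<n] \<in> T" by blast
  define c where "c n = \<phi> (map x [0..<n])" for n
  have "c n \<in> T'" for n
    unfolding c_def by (intro maps x)
  moreover have "strict_prefix (c n) (c (Suc n))" for n
    unfolding c_def by (rule mono[OF x x]) (simp add: strict_prefix_def)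
  ultimately show False
    using wf_tree_imp_wf[OF assms(1,2)] unfolding wf_iff_no_infinite_down_chain by blast
qed

lemma node_rank_le_if_strict_prefix_map:
  assumes T: "is_tree T" and T': "is_tree T'" "wf_tree T'"
    and maps: "\<And>t. t \<in> T \<Longrightarrow> \<phi> t \<in> T'"
    and mono: "\<And>s t. s \<in> T \<Longrightarrow> t \<in> T \<Longrightarrow> strict_prefix t s \<Longrightarrow> strict_prefix (\<phi> t) (\<phi> s)"
    and "t \<in> T"
  shows "node_rank T t \<le> node_rank T' (\<phi> t)"
proof -
  have wf: "wf_tree T"
    by (rule wf_tree_if_strict_prefix_map[OF T' maps mono])
  show ?thesis
    using wf_tree_imp_wf[OF T wf] \<open>t \<in> T\<close>
  proof (induction t rule: wf_induct_rule)
    case (less t)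
    have "node_rank T s < node_rank T' (\<phi> t)" if s: "s \<in> T" "strict_prefix t s" for s
    proof -
      have "node_rank T s \<le> node_rank T' (\<phi> s)"
        using less s by simp
      also have "\<dots> < node_rank T' (\<phi> t)"
        using less.prems s by (intro node_rank_strict_antimono T' maps mono)
      finally show ?thesis .
    qed
    then show ?case
      by (auto simp: node_rank_eq[OF T wf less.prems] osuc_le_iff intro!: Sup_ordinal_least)
  qed
qed

text \<open>A map transfers well-foundedness only from its target to its source. With maps in both
  directions the two trees fall into the same case of \<open>tree_rank\<close>, so that ranks of nodes are
  compared with each other only and never with \<open>omega1\<close>.\<close>

lemma tree_rank_eqI:
  assumes T: "is_tree T" and T': "is_tree T'"
    and maps: "\<And>t. t \<in> T \<Longrightarrow> \<phi> t \<in> T'"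
    and mono: "\<And>s t. s \<in> T \<Longrightarrow> t \<in> T \<Longrightarrow> strict_prefix t s \<Longrightarrow> strict_prefix (\<phi> t) (\<phi> s)"
    and maps': "\<And>t. t \<in> T' \<Longrightarrow> \<psi> t \<in> T"
    and mono': "\<And>s t. s \<in> T' \<Longrightarrow> t \<in> T' \<Longrightarrow> strict_prefix t s \<Longrightarrow> strict_prefix (\<psi> t) (\<psi> s)"
  shows "tree_rank T = tree_rank T'"
proof -
  have empty: "T = {} \<longleftrightarrow> T' = {}"
    using maps maps' by blast
  have wf: "wf_tree T \<longleftrightarrow> wf_tree T'"
  proof
    show "wf_tree T" if "wf_tree T'"
      by (rule wf_tree_if_strict_prefix_map[OF T' that maps mono])
    show "wf_tree T'" if "wf_tree T"
      by (rule wf_tree_if_strict_prefix_map[OF T that maps' mono'])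
  qed
  have root: "node_rank T [] = node_rank T' []" if "T \<noteq> {}" "wf_tree T"
  proof (rule antisym)
    have wf': "wf_tree T'" using wf that by simp
    have "[] \<in> T" "[] \<in> T'"
      using T T' that(1) empty by (auto simp: is_tree_def)
    \<comment> \<open>The root need not be sent to the root, but any other node has at most the rank of the root.\<close>
    have "node_rank T [] \<le> node_rank T' (\<phi> [])"
      by (rule node_rank_le_if_strict_prefix_map[OF T T' wf' maps mono \<open>[] \<in> T\<close>])
    also have "\<dots> \<le> node_rank T' []"
      using maps \<open>[] \<in> T\<close> \<open>[] \<in> T'\<close> by (intro node_rank_antimono T' wf') simp_all
    finally show "node_rank T [] \<le> node_rank T' []" .
    have "node_rank T' [] \<le> node_rank T (\<psi> [])"
      by (rule node_rank_le_if_strict_prefix_map[OF T' T that(2) maps' mono' \<open>[] \<in> T'\<close>])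
    also have "\<dots> \<le> node_rank T []"
      using maps' \<open>[] \<in> T\<close> \<open>[] \<in> T'\<close> by (intro node_rank_antimono T that(2)) simp_all
    finally show "node_rank T' [] \<le> node_rank T []" .
  qed
  show ?thesis
    using empty wf root by (simp add: tree_rank_def)
qed

section \<open>Centralizer trees of isomorphic groups\<close>

lemma (in monoid) centralizer_iso_image:
  assumes f: "f \<in> iso G H" and A: "A \<subseteq> carrier G"
  shows "centralizer H (f ` A) = f ` centralizer G A"
proof -
  have "f x \<otimes>\<^bsub>H\<^esub> f a = f a \<otimes>\<^bsub>H\<^esub> f x \<longleftrightarrow> x \<otimes> a = a \<otimes> x"
    if "x \<in> carrier G" "a \<in> A" for x a
  proof -
    have xa: "x \<in> carrier G" "a \<in> carrier G" using that A by auto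
    have "f x \<otimes>\<^bsub>H\<^esub> f a = f (x \<otimes> a)" "f a \<otimes>\<^bsub>H\<^esub> f x = f (a \<otimes> x)"
      using f xa by (simp_all add: iso_def hom_def)
    moreover have "inj_on f (carrier G)"
      using f by (simp add: iso_def bij_betw_def)
    ultimately show ?thesis
      using xa by (simp add: inj_on_eq_iff)
  qed
  moreover have "carrier H = f ` carrier G"
    using f by (simp add: iso_def bij_betw_def)
  ultimately show ?thesis
    by (auto simp: centralizer_def)
qed

text \<open>Membership in the tree depends on an entry of a sequence only through the group element that
  it names, so \<open>h\<close> may be any choice of names for the images under \<open>f\<close>; \<open>g'\<close> may repeat values.
  Injectivity of \<open>f\<close> keeps distinct centralizers distinct.\<close>

lemma (in monoid) map_in_cent_tree:
  assumes f: "f \<in> iso G H" and g: "range g \<subseteq> carrier G"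
    and h: "\<And>i. g' (h i) = f (g i)"
    and "s \<in> cent_tree G g"
  shows "map h s \<in> cent_tree H g'"
  using \<open>s \<in> cent_tree G g\<close>
proof (induction rule: cent_tree.induct)
  case Nil
  show ?case by (simp add: cent_tree.Nil)
next
  case (snoc s i)
  have sub: "g ` set s \<union> {g i} \<subseteq> carrier G" "g ` set s \<subseteq> carrier G"
    using g by auto
  have inj: "inj_on f (carrier G)"
    using f by (simp add: iso_def bij_betw_def)
  have img: "g' ` set (map h s) = f ` (g ` set s)"
    by (simp add: image_image h)
  have img': "g' ` set (map h s) \<union> {g' (h i)} = f ` (g ` set s \<union> {g i})"
    using img by (simp add: h)
  have "centralizer G A \<subseteq> carrier G" for A
    by (auto simp: centralizer_def)
  then have "f ` centralizer G (g ` set s \<union> {g i}) \<noteq> f ` centralizer G (g ` set s)"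
    using snoc.hyps(2) by (simp only: inj_on_image_eq_iff[OF inj] not_False_eq_True)
  then have "centralizer H (g' ` set (map h s) \<union> {g' (h i)}) \<noteq> centralizer H (g' ` set (map h s))"
    unfolding img' unfolding img centralizer_iso_image[OF f sub(1)] centralizer_iso_image[OF f sub(2)] .
  then show ?case
    using cent_tree.snoc[OF snoc.IH] by simp
qed

lemma (in monoid) obtain_cent_tree_map:
  assumes f: "f \<in> iso G H" and g: "range g \<subseteq> carrier G" and g': "carrier H \<subseteq> range g'"
  obtains h where "\<And>s. s \<in> cent_tree G g \<Longrightarrow> map h s \<in> cent_tree H g'"
proof -
  have "\<exists>j. g' j = f (g i)" for i
  proof -
    have "f (g i) \<in> carrier H"
      using f g by (auto simp: iso_def hom_def)
    then show ?thesis using g' by force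
  qed
  then obtain h where "\<And>i. g' (h i) = f (g i)" by metis
  then show thesis
    using map_in_cent_tree[OF f g] that by blast
qed

lemma strict_prefix_map: "strict_prefix t s \<Longrightarrow> strict_prefix (map h t) (map h s)"
  by (auto simp: strict_prefix_def prefix_def)

text \<open>Any two enumerations of isomorphic groups may be compared, in particular two enumerations
  of the same group: the rank is an invariant of the abstract group.\<close>

theorem tree_rank_cent_tree_iso:
  assumes "group G" "group H" "G \<cong> H"
    and g: "range g = carrier G" and g': "range g' = carrier H"
  shows "tree_rank (cent_tree G g) = tree_rank (cent_tree H g')"
proof -
  interpret G: group G by fact
  interpret H: group H by fact
  from \<open>G \<cong> H\<close> obtain f where f: "f \<in> iso G H"
    by (auto simp: is_iso_def)
  obtain h where h: "\<And>s. s \<in> cent_tree G g \<Longrightarrow> map h s \<in> cent_tree H g'"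
    by (rule G.obtain_cent_tree_map[OF f equalityD1[OF g] equalityD2[OF g']]) blast
  from G.iso_sym[OF \<open>G \<cong> H\<close>] obtain f' where f': "f' \<in> iso H G"
    by (auto simp: is_iso_def)
  obtain h' where h': "\<And>s. s \<in> cent_tree H g' \<Longrightarrow> map h' s \<in> cent_tree G g"
    by (rule H.obtain_cent_tree_map[OF f' equalityD1[OF g'] equalityD2[OF g]]) blast
  show ?thesis
    by (rule tree_rank_eqI[where \<phi> = "map h" and \<psi> = "map h'"])
      (simp_all add: is_tree_cent_tree h h' strict_prefix_map)
qed

lemma range_marked_enum:
  assumes "range \<gamma> = carrier F_omega" and N: "N \<lhd> F_omega"
  shows "range (marked_enum \<gamma> N) = carrier (F_omega Mod N)"
proof -
  have "range (marked_enum \<gamma> N) = (\<lambda>x. x <#\<^bsub>F_omega\<^esub> N) ` range \<gamma>"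
    unfolding image_image marked_enum_def ..
  also have "\<dots> = (\<lambda>x. N #>\<^bsub>F_omega\<^esub> x) ` carrier F_omega"
    unfolding assms(1) by (rule image_cong) (rule HOL.refl, metis normal.coset_eq[OF N])
  also have "\<dots> = carrier (F_omega Mod N)"
    unfolding FactGroup_def RCOSETS_def by auto
  finally show ?thesis .
qed

theorem corollary3p6:
  fixes \<gamma> :: "nat \<Rightarrow> free_elt" and N N' :: "free_elt set"
  assumes "range \<gamma> = carrier F_omega"
    and "N \<lhd> F_omega" and "N' \<lhd> F_omega"
    and "F_omega Mod N \<cong> F_omega Mod N'"
  shows "tree_rank (marked_cent_tree \<gamma> N) = tree_rank (marked_cent_tree \<gamma> N')"
  unfolding marked_cent_tree_def
  using assms by (intro tree_rank_cent_tree_iso range_marked_enum normal.factorgroup_is_group)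

end
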